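(* Let $n \geq 1$ and let $A \in \mathbb{R}^{n \times n}$ be a real square matrix. Then there exist matrices $S, \Lambda \in \mathbb{C}^{n \times n}$, where $S$ is unitary and $\Lambda$ is diagonal, such that $A = \mathrm{Re}(S \Lambda S^* )$.
   Context: For a complex matrix $S$, $S^* = \overline{S}^{\top}$ denotes the conjugate transpose, and $\mathrm{Re}(\cdot)$ denotes the entrywise real part. $S \in \mathbb{C}^{n\times n}$ is unitary if $SS^* = S^*S = I$. *)

theory Defs
  imports "Jordan_Normal_Form.Schur_Decomposition"
begin

text \<open>For complex entries, the library's \<^const>\<open>mat_adjoint\<close> is the conjugate transpose.\<close>

lemma mat_adjoint_conjugate_transpose:
  fixes S :: "complex mat"
  shows "mat_adjoint S = transpose_mat (map_mat cnj S)"
  by (rule eq_matI) (auto simp: mat_adjoint_def mat_of_rows_index)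

text \<open>No separate squareness condition is needed: the two identity matrices have the same
  size, and by the second equation this size is also the number of columns of \<open>S\<close>.\<close>

definition unitary_mat :: "complex mat \<Rightarrow> bool" where
  "unitary_mat S \<longleftrightarrow>
     S * mat_adjoint S = 1\<^sub>m (dim_row S) \<and> mat_adjoint S * S = 1\<^sub>m (dim_row S)"

end

(* For real A the matrix X = A + i A^T satisfies X^* = -i X, so (1 - i) X is Hermitian.
   Hence X is a complex multiple of a Hermitian matrix, is unitarily diagonalizable by the
   spectral theorem, and has real part A. *)
theory Submission
  imports Defs
begin

lemma mat_adjoint_carrier:
  fixes A :: "complex mat"
  assumes "A \<in> carrier_mat m n"
  shows "mat_adjoint A \<in> carrier_mat n m"
  using assms by (simp add: mat_adjoint_conjugate_transpose)

lemma mat_adjoint_index: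
  fixes A :: "complex mat"
  assumes "i < dim_col A" "j < dim_row A"
  shows "mat_adjoint A $$ (i, j) = cnj (A $$ (j, i))"
  using assms by (simp add: mat_adjoint_conjugate_transpose)

lemma mat_adjoint_mult:
  fixes A B :: "complex mat"
  assumes "A \<in> carrier_mat m n" "B \<in> carrier_mat n k"
  shows "mat_adjoint (A * B) = mat_adjoint B * mat_adjoint A"
  by (rule eq_matI)
    (use assms in \<open>auto simp: mat_adjoint_conjugate_transpose scalar_prod_def mult.commute intro!: sum.cong\<close>)

lemma mat_adjoint_adjoint:
  fixes A :: "complex mat"
  shows "mat_adjoint (mat_adjoint A) = A"
  by (rule eq_matI) (auto simp: mat_adjoint_conjugate_transpose)

lemma mat_adjoint_one: "mat_adjoint (1\<^sub>m k) = (1\<^sub>m k :: complex mat)"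
  by (rule eq_matI) (auto simp: mat_adjoint_conjugate_transpose)

lemma mat_adjoint_four_block_diag:
  fixes A D :: "complex mat"
  assumes "A \<in> carrier_mat m m" "D \<in> carrier_mat k k"
  shows "mat_adjoint (four_block_mat A (0\<^sub>m m k) (0\<^sub>m k m) D)
    = four_block_mat (mat_adjoint A) (0\<^sub>m m k) (0\<^sub>m k m) (mat_adjoint D)"
  by (rule eq_matI) (use assms in \<open>auto simp: mat_adjoint_conjugate_transpose\<close>)

lemma mult_four_block_diag:
  fixes A1 A2 D1 D2 :: "'a :: comm_ring_1 mat"
  assumes "A1 \<in> carrier_mat m m" "A2 \<in> carrier_mat m m"
    "D1 \<in> carrier_mat k k" "D2 \<in> carrier_mat k k"
  shows "four_block_mat A1 (0\<^sub>m m k) (0\<^sub>m k m) D1 * four_block_mat A2 (0\<^sub>m m k) (0\<^sub>m k m) D2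
    = four_block_mat (A1 * A2) (0\<^sub>m m k) (0\<^sub>m k m) (D1 * D2)"
  by (subst mult_four_block_mat[OF assms(1) _ _ assms(3) assms(2) _ _ assms(4)])
    (use assms in auto)

text \<open>For square matrices a left inverse is also a right inverse, so one of the two defining
  equations suffices.\<close>

lemma unitary_matI:
  assumes "S \<in> carrier_mat n n" "mat_adjoint S * S = 1\<^sub>m n"
  shows "unitary_mat S"
  using mat_mult_left_right_inverse[OF mat_adjoint_carrier[OF assms(1)] assms]
    assms by (auto simp: unitary_mat_def)

lemma unitary_mat_mult:
  assumes S: "S \<in> carrier_mat n n" "unitary_mat S" and T: "T \<in> carrier_mat n n" "unitary_mat T"
  shows "unitary_mat (S * T)"
proof (rule unitary_matI)
  note c = S(1) T(1) mat_adjoint_carrier[OF S(1)] mat_adjoint_carrier[OF T(1)]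
  have "mat_adjoint (S * T) * (S * T) = mat_adjoint T * ((mat_adjoint S * S) * T)"
    using c by (simp add: mat_adjoint_mult[OF S(1) T(1)] assoc_mult_mat[of _ n n _ n _ n])
  also have "\<dots> = 1\<^sub>m n"
    using S T c by (simp add: unitary_mat_def)
  finally show "mat_adjoint (S * T) * (S * T) = 1\<^sub>m n" .
qed (use S T in auto)

text \<open>Scaling \<open>w\<close> by \<open>c\<close> multiplies its square norm by
  \<open>c * cnj c\<close>. That square norm is a positive real \<open>r\<close>, so
  \<open>c\<close> = 1 / sqrt \<open>r\<close> yields a unit vector.\<close>

lemma ex_normalizing_scalar:
  fixes w :: "complex vec"
  assumes "w \<bullet>c w \<noteq> 0"
  shows "\<exists>c. c * cnj c * (w \<bullet>c w) = 1"
proof -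
  have "w \<bullet>c w \<ge> 0" by (rule conjugate_square_ge_0_vec)
  \<comment> \<open>The order on the complex numbers compares only numbers with equal imaginary
    part, so being at least 0 already means being real.\<close>
  then obtain r where r: "w \<bullet>c w = complex_of_real r" "r \<ge> 0"
    by (metis less_eq_complex_def complex_is_Real_iff Reals_cases Im_complex_of_real Re_complex_of_real
        zero_complex.sel)
  with assms have "r > 0" by auto
  then show ?thesis
    by (intro exI[of _ "complex_of_real (1 / sqrt r)"])
      (auto simp: r(1) simp flip: of_real_mult)
qed

text \<open>Complete \<open>v\<close> to a basis and orthogonalize it. Gram-Schmidt leaves the first
  vector alone, so normalizing the resulting vectors only rescales \<open>v\<close> in column
  0.\<close>

lemma unitary_mat_with_first_column:
  fixes v :: "complex vec"
  assumes v: "v \<in> carrier_vec n" "v \<noteq> 0\<^sub>v n"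
  obtains W c where "W \<in> carrier_mat n n" "unitary_mat W" "col W 0 = c \<cdot>\<^sub>v v"
proof -
  interpret cof_vec_space n "TYPE(complex)" .
  define b where "b = basis_completion v"
  define ws where "ws = gram_schmidt n b"
  note bc = basis_completion[OF v, folded b_def]
  have n: "0 < n" using v by (cases n) auto
  from bc(6,7) n obtain vs where bv: "b = v # vs" by (cases b) auto
  have ws: "set ws \<subseteq> carrier_vec n" "corthogonal ws" "length ws = n"
    using gram_schmidt_result[OF bc(2,4,5) refl, folded ws_def] bc(6) by auto
  have "hd ws = v"
    using gram_schmidt_hd[OF v(1), of vs] bv by (simp add: ws_def)
  with n ws(3) have ws0: "ws ! 0 = v" by (metis hd_conv_nth list.size(3) less_irrefl)
  have wsc: "ws ! i \<in> carrier_vec n" if "i < n" for i using ws that by auto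
  \<comment> \<open>The equivalence also says that each \<open>ws ! i\<close> has nonzero square
    norm, which is what makes normalization possible.\<close>
  have orth: "ws ! i \<bullet>c ws ! j = 0 \<longleftrightarrow> i \<noteq> j" if "i < n" "j < n" for i j
    using corthogonalD[OF ws(2)] ws(3) that by auto
  have "\<forall>i. \<exists>c. i < n \<longrightarrow> c * cnj c * (ws ! i \<bullet>c ws ! i) = 1"
    using ex_normalizing_scalar orth by blast
  then obtain f where f: "\<And>i. i < n \<Longrightarrow> f i * cnj (f i) * (ws ! i \<bullet>c ws ! i) = 1"
    by metis
  define W where "W = mat n n (\<lambda>(k, i). f i * ws ! i $ k)"
  have W: "W \<in> carrier_mat n n" by (simp add: W_def)
  have colW: "col W i = f i \<cdot>\<^sub>v ws ! i" if "i < n" for i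
    using that wsc[OF that] by (intro eq_vecI) (auto simp: W_def)
  have "mat_adjoint W * W = 1\<^sub>m n"
  proof (rule eq_matI)
    fix i j assume "i < dim_row (1\<^sub>m n :: complex mat)" "j < dim_col (1\<^sub>m n :: complex mat)"
    then have ij: "i < n" "j < n" by auto
    have "(mat_adjoint W * W) $$ (i, j) = (\<Sum>k<n. cnj (f i * ws ! i $ k) * (f j * ws ! j $ k))"
      using ij W by (auto simp: mat_adjoint_conjugate_transpose scalar_prod_def W_def lessThan_atLeast0)
    \<comment> \<open>\<open>\<bullet>c\<close> conjugates its second argument, so the conjugated
      column \<open>i\<close> comes second.\<close>
    also have "\<dots> = cnj (f i) * f j * (ws ! j \<bullet>c ws ! i)"
      using wsc[OF ij(1)] wsc[OF ij(2)]
      by (auto simp: scalar_prod_def sum_distrib_left lessThan_atLeast0 intro!: sum.cong)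
    also have "\<dots> = 1\<^sub>m n $$ (i, j)"
      using ij orth[of j i] f[of i] by (auto simp: mult.commute)
    finally show "(mat_adjoint W * W) $$ (i, j) = 1\<^sub>m n $$ (i, j)" .
  qed (use W in \<open>auto simp: mat_adjoint_conjugate_transpose\<close>)
  from that[OF W unitary_matI[OF W this], of "f 0"] colW[OF n] ws0 show ?thesis by simp
qed

text \<open>By the fundamental theorem of algebra the characteristic polynomial splits into
  \<open>n\<close> linear factors; for positive \<open>n\<close> there is at least one, and its root
  is an eigenvalue.\<close>

lemma complex_eigenvector_exists:
  fixes A :: "complex mat"
  assumes A: "A \<in> carrier_mat n n" and "n > 0"
  obtains v e where "v \<in> carrier_vec n" "v \<noteq> 0\<^sub>v n" "A *\<^sub>v v = e \<cdot>\<^sub>v v"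
proof -
  obtain es where es: "char_poly A = (\<Prod>a\<leftarrow>es. [:- a, 1:])" "length es = n"
    using char_poly_factorized[OF A] by blast
  with \<open>n > 0\<close> obtain e es' where "es = e # es'" by (cases es) auto
  with es have "eigenvalue A e" by (simp add: eigenvalue_root_char_poly[OF A])
  then show ?thesis
    using A that by (auto simp: eigenvalue_def eigenvector_def)
qed

text \<open>Deflation: the unitary \<open>W\<close> starts with an eigenvector, so \<open>W\<^sup>* H W\<close> has first column
  \<open>(e, 0, \<dots>, 0)\<close>; being Hermitian, it is block diagonal.\<close>
lemma hermitian_unitarily_diagonalizable:
  fixes H :: "complex mat"
  assumes "H \<in> carrier_mat n n" "mat_adjoint H = H"
  shows "\<exists>S \<in> carrier_mat n n. \<exists>\<Lambda> \<in> carrier_mat n n.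
    unitary_mat S \<and> diagonal_mat \<Lambda> \<and> H = S * \<Lambda> * mat_adjoint S"
  using assms
proof (induction n arbitrary: H)
  case 0
  then show ?case
    by (intro bexI[of _ H]) (auto simp: unitary_mat_def diagonal_mat_def mat_adjoint_conjugate_transpose)
next
  case (Suc m)
  note H = Suc.prems
  let ?n = "Suc m"
  obtain v e where v: "v \<in> carrier_vec ?n" "v \<noteq> 0\<^sub>v ?n" "H *\<^sub>v v = e \<cdot>\<^sub>v v"
    using complex_eigenvector_exists[OF H(1)] by blast
  obtain W c where W: "W \<in> carrier_mat ?n ?n" "unitary_mat W" and col0: "col W 0 = c \<cdot>\<^sub>v v"
    using unitary_mat_with_first_column[OF v(1,2)] by blast
  note W' = mat_adjoint_carrier[OF W(1)]
  have WW: "mat_adjoint W * W = 1\<^sub>m ?n" "W * mat_adjoint W = 1\<^sub>m ?n"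
    using W by (auto simp: unitary_mat_def)
  note assoc = assoc_mult_mat[of _ ?n ?n _ ?n _ ?n]
  define K where "K = mat_adjoint W * (H * W)"
  have K: "K \<in> carrier_mat ?n ?n" using W' H W by (simp add: K_def)
  have Kherm: "mat_adjoint K = K"
    using W W' H by (simp add: K_def mat_adjoint_mult[of _ ?n ?n _ ?n] mat_adjoint_adjoint assoc)
  have HK: "H = W * K * mat_adjoint W"
  proof -
    have "W * K * mat_adjoint W = (W * mat_adjoint W) * H * (W * mat_adjoint W)"
      using W(1) W' H(1) by (simp add: K_def assoc)
    then show ?thesis using H(1) by (simp add: WW)
  qed
  have col: "col (A * B) 0 = A *\<^sub>v col B 0"
    if "A \<in> carrier_mat ?n ?n" "B \<in> carrier_mat ?n ?n" for A B :: "complex mat"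
    using that by (rule col_mult2) simp
  \<comment> \<open>Column 0 of \<open>W\<close> is a multiple of \<open>v\<close>, so
    \<open>H\<close> multiplies it by \<open>e\<close>; then W^* maps it to column 0 of W^* W, the
    first unit vector.\<close>
  have "col K 0 = mat_adjoint W *\<^sub>v (H *\<^sub>v col W 0)"
    unfolding K_def using col[OF W', of "H * W"] col[OF H(1) W(1)] W(1) H(1) by (metis mult_carrier_mat)
  also have "H *\<^sub>v col W 0 = e \<cdot>\<^sub>v col W 0"
    using v H(1) by (simp add: col0 mult_mat_vec[of _ ?n ?n] smult_smult_assoc mult.commute)
  also have "mat_adjoint W *\<^sub>v (e \<cdot>\<^sub>v col W 0) = e \<cdot>\<^sub>v col (mat_adjoint W * W) 0"
    unfolding col[OF W' W(1)] using W' v(1) by (intro mult_mat_vec) (auto simp: col0)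
  finally have colK: "col K 0 = e \<cdot>\<^sub>v unit_vec ?n 0" by (simp add: WW)
  have K0: "K $$ (i, 0) = (if i = 0 then e else 0)" if "i < ?n" for i
    using arg_cong[OF colK, of "\<lambda>u. u $ i"] that K by auto
  \<comment> \<open>The first row is the conjugate of the first column, because \<open>K\<close> is
    Hermitian.\<close>
  have K0': "K $$ (0, i) = 0" if "0 < i" "i < ?n" for i
    using K0[of i] that K mat_adjoint_index[of 0 K i] by (auto simp: Kherm)
  define E where "E = mat 1 1 (\<lambda>_. e)"
  define L where "L = mat m m (\<lambda>(i, j). K $$ (Suc i, Suc j))"
  have E: "E \<in> carrier_mat 1 1" and L: "L \<in> carrier_mat m m" by (auto simp: E_def L_def)
  have KEL: "K = four_block_mat E (0\<^sub>m 1 m) (0\<^sub>m m 1) L"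
    using K by (intro eq_matI) (auto simp: E_def L_def K0 K0')
  have "mat_adjoint L = L"
  proof (rule eq_matI)
    fix i j assume "i < dim_row L" "j < dim_col L"
    then have ij: "i < m" "j < m" using L by auto
    \<comment> \<open>\<open>L\<close> inherits the symmetry of \<open>K\<close> at indices shifted
      by one.\<close>
    then show "mat_adjoint L $$ (i, j) = L $$ (i, j)"
      using mat_adjoint_index[of "Suc i" K "Suc j"] K L
      by (auto simp: mat_adjoint_index Kherm) (simp add: L_def)
  qed (use L in \<open>auto simp: mat_adjoint_conjugate_transpose\<close>)
  from Suc.IH[OF L this] obtain P D where P: "P \<in> carrier_mat m m" "unitary_mat P"
    and D: "D \<in> carrier_mat m m" "diagonal_mat D" and LPD: "L = P * D * mat_adjoint P"
    by blast
  note P' = mat_adjoint_carrier[OF P(1)]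
  let ?b = "\<lambda>A B. four_block_mat A (0\<^sub>m 1 m) (0\<^sub>m m 1) B"
  \<comment> \<open>Bordering \<open>P\<close> with a 1 extends the diagonalization of
    \<open>L\<close> to one of \<open>K\<close>: the corner \<open>E\<close> is left unchanged, and
    the other block becomes P D P^* = \<open>L\<close>.\<close>
  define Q where "Q = ?b (1\<^sub>m 1) P"
  define \<Lambda> where "\<Lambda> = ?b E D"
  have Q: "Q \<in> carrier_mat ?n ?n" and \<Lambda>: "\<Lambda> \<in> carrier_mat ?n ?n"
    using P(1) D(1) E by (auto simp: Q_def \<Lambda>_def)
  have Q'eq: "mat_adjoint Q = ?b (1\<^sub>m 1) (mat_adjoint P)"
    unfolding Q_def by (subst mat_adjoint_four_block_diag[OF _ P(1)]) (simp_all add: mat_adjoint_one)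
  note Q' = mat_adjoint_carrier[OF Q]
  have "mat_adjoint Q * Q = ?b (1\<^sub>m 1) (1\<^sub>m m)"
    using P P' by (simp add: Q'eq) (simp add: Q_def mult_four_block_diag unitary_mat_def)
  then have "mat_adjoint Q * Q = 1\<^sub>m ?n" by simp
  then have Qu: "unitary_mat Q" by (rule unitary_matI[OF Q])
  have KQ: "K = Q * \<Lambda> * mat_adjoint Q"
    using P(1) P' D(1) E
    by (simp add: Q'eq) (simp add: Q_def \<Lambda>_def mult_four_block_diag KEL LPD)
  have "diagonal_mat \<Lambda>"
    using D E by (auto simp: \<Lambda>_def diagonal_mat_def)
  \<comment> \<open>Substitute K = Q \<Lambda> Q^* into H = W K W^* and use Q^* W^* = (W
    Q)^*.\<close>
  moreover have "H = (W * Q) * \<Lambda> * mat_adjoint (W * Q)"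
    using W(1) W' Q Q' \<Lambda> by (simp add: HK KQ mat_adjoint_mult[of _ ?n ?n _ ?n] assoc)
  ultimately show ?case
    using unitary_mat_mult[OF W Q Qu] W(1) Q \<Lambda>
    by (intro bexI[of _ "W * Q"] bexI[of _ \<Lambda>]) auto
qed

theorem corollary1:
  fixes n :: nat and A :: "real mat"
  assumes "n \<ge> 1"
    and "A \<in> carrier_mat n n"
  shows "\<exists>S \<in> carrier_mat n n. \<exists>\<Lambda> \<in> carrier_mat n n.
    unitary_mat S \<and> diagonal_mat \<Lambda> \<and> A = map_mat Re (S * \<Lambda> * mat_adjoint S)"
proof -
  \<comment> \<open>\<open>H = (1 - \<i>) (A + \<i> A\<^sup>T)\<close>, so that \<open>(1 + \<i>) / 2 \<cdot> H = A + \<i> A\<^sup>T\<close>.\<close>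
  define H where "H = mat n n (\<lambda>(i, j). Complex (A $$ (i, j) + A $$ (j, i)) (A $$ (j, i) - A $$ (i, j)))"
  have H: "H \<in> carrier_mat n n" by (simp add: H_def)
  have "mat_adjoint H = H"
    by (rule eq_matI) (auto simp: H_def mat_adjoint_conjugate_transpose complex_eq_iff)
  from hermitian_unitarily_diagonalizable[OF H this] obtain S D
    where S: "S \<in> carrier_mat n n" "unitary_mat S" and D: "D \<in> carrier_mat n n" "diagonal_mat D"
      and HSD: "H = S * D * mat_adjoint S" by blast
  let ?c = "Complex (1/2) (1/2)"
  note S' = mat_adjoint_carrier[OF S(1)]
  \<comment> \<open>The scalar is absorbed into the diagonal factor, so \<open>S\<close> stays
    unitary; the new diagonal need not be real.\<close>
  have "S * (?c \<cdot>\<^sub>m D) * mat_adjoint S = ?c \<cdot>\<^sub>m H"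
    using S(1) S' D(1) by (simp add: HSD mult_smult_distrib[of _ n n _ n] mult_smult_assoc_mat[of _ n n _ n])
  \<comment> \<open>With a = \<open>A $$ (i, j)\<close> and b = \<open>A $$ (j, i)\<close>, the real
    part of the entry is ((a + b) - (b - a)) / 2 = a.\<close>
  moreover have "A = map_mat Re (?c \<cdot>\<^sub>m H)"
    using assms(2) by (intro eq_matI) (auto simp: H_def field_simps)
  moreover have "diagonal_mat (?c \<cdot>\<^sub>m D)"
    using D by (auto simp: diagonal_mat_def)
  ultimately show ?thesis
    using S D(1) by (intro bexI[of _ S] bexI[of _ "?c \<cdot>\<^sub>m D"]) auto
qed

end
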